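(* Let $G$ be a graph. Then $G$ is a Cayley graph (i.e. $G$ is isomorphic to $\mathcal{C}\langle\mathsf{G},\mathsf{H}\rangle$ for some group $\mathsf{G}$, some non-empty generating subset $\mathsf{H}\subseteq\mathsf{G}$ and some injective labelling $\langle\ \rangle:\mathsf{H}\to A$) if and only if $G$ is deterministic, rooted, simple and vertex-transitive.
   Context: Fix an arbitrary set $A$ of labels. A graph is a non-empty set $G\subseteq V\times A\times V$ of labelled edges; an edge $(s,a,t)$ is written $s\xrightarrow{a}t$. Its vertex set $V_G$ is the set of vertices occurring as source or goal of some edge (there are no isolated vertices). Graphs $G,H$ are isomorphic if there is a bijection $f:V_G\to V_H$ with $s\xrightarrow{a}_G t \iff f(s)\xrightarrow{a}_H f(t)$; an automorphism of $G$ is an isomorphism from $G$ to $G$. $G$ is simple if $s\xrightarrow{a}t$ and $s\xrightarrow{b}t$ imply $a=b$; deterministic if $r\xrightarrow{a}s$ and $r\xrightarrow{a}t$ imply $s=t$. A vertex $r$ is a root if every vertex of $G$ is reachable from $r$ by a directed path; $G$ is rooted if it has a root. $G$ is vertex-transitive if for all $s,t\in V_G$ there is an automorphism $h$ of $G$ with $h(s)=t$. For a group $(\mathsf{G},\cdot)$, a non-empty subset $\mathsf{H}\subseteq\mathsf{G}$ and an injective map $\langle\ \rangle:\mathsf{H}\to A$, the Cayley graph is $\mathcal{C}\langle\mathsf{G},\mathsf{H}\rangle=\{(g,\langle h\rangle,g\cdot h)\mid g\in\mathsf{G},h\in\mathsf{H}\}$. $\mathsf{H}$ is generating if every element of $\mathsf{G}$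 is a finite (possibly empty) product of elements of $\mathsf{H}$. *)

theory Defs
  imports "HOL-Algebra.Group"
begin

text \<open>
  A graph is a set of triples (source, label, goal). The label set \<open>A\<close> is an explicit set,
  and the ambient set of potential vertices is the whole type \<open>'v\<close>.
\<close>

type_synonym ('v, 'a) lgraph = "('v \<times> 'a \<times> 'v) set"

definition graph :: "'a set \<Rightarrow> ('v, 'a) lgraph \<Rightarrow> bool" where
  "graph A G \<longleftrightarrow> G \<noteq> {} \<and> G \<subseteq> UNIV \<times> A \<times> UNIV"

definition vertices :: "('v, 'a) lgraph \<Rightarrow> 'v set" where
  "vertices G = {v. \<exists>a t. (v, a, t) \<in> G \<or> (t, a, v) \<in> G}"

definition graph_isomorphism ::
    "('v \<Rightarrow> 'w) \<Rightarrow> ('v, 'a) lgraph \<Rightarrow> ('w, 'a) lgraph \<Rightarrow> bool" where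
  "graph_isomorphism f G H \<longleftrightarrow>
     bij_betw f (vertices G) (vertices H) \<and>
     (\<forall>s\<in>vertices G. \<forall>t\<in>vertices G. \<forall>a. (s, a, t) \<in> G \<longleftrightarrow> (f s, a, f t) \<in> H)"

definition isomorphic_graphs :: "('v, 'a) lgraph \<Rightarrow> ('w, 'a) lgraph \<Rightarrow> bool" where
  "isomorphic_graphs G H \<longleftrightarrow> (\<exists>f. graph_isomorphism f G H)"

definition graph_automorphism :: "('v \<Rightarrow> 'v) \<Rightarrow> ('v, 'a) lgraph \<Rightarrow> bool" where
  "graph_automorphism h G \<longleftrightarrow> graph_isomorphism h G G"

definition simple_graph :: "('v, 'a) lgraph \<Rightarrow> bool" where
  "simple_graph G \<longleftrightarrow> (\<forall>s t a b. (s, a, t) \<in> G \<and> (s, b, t) \<in> G \<longrightarrow> a = b)"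

definition deterministic_graph :: "('v, 'a) lgraph \<Rightarrow> bool" where
  "deterministic_graph G \<longleftrightarrow> (\<forall>r a s t. (r, a, s) \<in> G \<and> (r, a, t) \<in> G \<longrightarrow> s = t)"

definition step_rel :: "('v, 'a) lgraph \<Rightarrow> ('v \<times> 'v) set" where
  "step_rel G = {(s, t). \<exists>a. (s, a, t) \<in> G}"

definition graph_root :: "('v, 'a) lgraph \<Rightarrow> 'v \<Rightarrow> bool" where
  "graph_root G r \<longleftrightarrow> r \<in> vertices G \<and> (\<forall>t\<in>vertices G. (r, t) \<in> (step_rel G)\<^sup>*)"

definition rooted_graph :: "('v, 'a) lgraph \<Rightarrow> bool" where
  "rooted_graph G \<longleftrightarrow> (\<exists>r. graph_root G r)"

definition vertex_transitive :: "('v, 'a) lgraph \<Rightarrow> bool" where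
  "vertex_transitive G \<longleftrightarrow>
     (\<forall>s\<in>vertices G. \<forall>t\<in>vertices G. \<exists>h. graph_automorphism h G \<and> h s = t)"

text \<open>
  Generation uses products only, without inverses, so it is not
  \<open>generate\<close> of \<open>HOL-Algebra.Generated_Groups\<close>.
\<close>

definition generating :: "('g, 'm) monoid_scheme \<Rightarrow> 'g set \<Rightarrow> bool" where
  "generating Gr H \<longleftrightarrow>
     (\<forall>g\<in>carrier Gr. \<exists>hs. set hs \<subseteq> H \<and> g = foldr (\<otimes>\<^bsub>Gr\<^esub>) hs \<one>\<^bsub>Gr\<^esub>)"

definition cayley_graph ::
    "('g, 'm) monoid_scheme \<Rightarrow> 'g set \<Rightarrow> ('g \<Rightarrow> 'a) \<Rightarrow> ('g, 'a) lgraph" where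
  "cayley_graph Gr H l = {(g, l h, g \<otimes>\<^bsub>Gr\<^esub> h) | g h. g \<in> carrier Gr \<and> h \<in> H}"

text \<open>
  HOL cannot quantify existentially over types, so the type \<open>'g\<close> in which the group lives
  is a parameter.
\<close>

definition is_cayley_graph :: "'g itself \<Rightarrow> 'a set \<Rightarrow> ('v, 'a) lgraph \<Rightarrow> bool" where
  "is_cayley_graph (_ :: 'g itself) A G \<longleftrightarrow>
     (\<exists>(Gr :: 'g monoid) H l.
        group Gr \<and> H \<subseteq> carrier Gr \<and> H \<noteq> {} \<and> generating Gr H \<and>
        inj_on l H \<and> l ` H \<subseteq> A \<and>
        isomorphic_graphs G (cayley_graph Gr H l))"

end

(* An automorphism of a deterministic graph is determined by its value at a root r, since it is
   forced along every path from r. So a vertex-transitive such graph has exactly one automorphism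
   phi s with phi s r = s for each vertex s, and s * t = phi s t turns the vertices into a group
   with neutral element r. The edges leaving r name the generators, and the Cayley graph of this
   group is the graph itself: (s, a, t) is an edge iff t = phi s h for some edge (r, a, h).
   Conversely, left translations make a Cayley graph vertex-transitive. *)

theory Submission
  imports Defs
begin

section \<open>Isomorphisms of labelled graphs\<close>

lemma edge_vertices:
  assumes "(s, a, t) \<in> G"
  shows "s \<in> vertices G" "t \<in> vertices G"
  using assms by (auto simp: vertices_def)

lemma graph_isomorphism_bij:
  "graph_isomorphism f G H \<Longrightarrow> bij_betw f (vertices G) (vertices H)"
  by (simp add: graph_isomorphism_def)

lemma graph_isomorphism_vertex:
  "graph_isomorphism f G H \<Longrightarrow> s \<in> vertices G \<Longrightarrow> f s \<in> vertices H"
  by (auto simp: graph_isomorphism_def bij_betw_def)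

lemma graph_isomorphism_edge_iff:
  "graph_isomorphism f G H \<Longrightarrow> s \<in> vertices G \<Longrightarrow> t \<in> vertices G \<Longrightarrow>
    (f s, a, f t) \<in> H \<longleftrightarrow> (s, a, t) \<in> G"
  by (simp add: graph_isomorphism_def)

lemma graph_isomorphism_edge:
  "graph_isomorphism f G H \<Longrightarrow> (s, a, t) \<in> G \<Longrightarrow> (f s, a, f t) \<in> H"
  by (simp add: graph_isomorphism_edge_iff edge_vertices)

lemma graph_isomorphism_id: "graph_isomorphism id G G"
  by (simp add: graph_isomorphism_def)

lemma graph_isomorphism_comp:
  assumes f: "graph_isomorphism f G H" and g: "graph_isomorphism g H K"
  shows "graph_isomorphism (g \<circ> f) G K"
  unfolding graph_isomorphism_def
  using bij_betw_trans[OF graph_isomorphism_bij[OF f] graph_isomorphism_bij[OF g]]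
  by (simp add: graph_isomorphism_edge_iff[OF f] graph_isomorphism_edge_iff[OF g]
      graph_isomorphism_vertex[OF f])

lemma graph_isomorphism_inv:
  assumes f: "graph_isomorphism f G H"
  shows "graph_isomorphism (inv_into (vertices G) f) H G"
proof -
  let ?g = "inv_into (vertices G) f"
  note bij = graph_isomorphism_bij[OF f]
  have "(s, a, t) \<in> H \<longleftrightarrow> (?g s, a, ?g t) \<in> G" if "s \<in> vertices H" "t \<in> vertices H" for s a t
    using that graph_isomorphism_edge_iff[OF f, of "?g s" "?g t" a]
      bij_betw_apply[OF bij_betw_inv_into[OF bij]]
    by (simp add: bij_betw_inv_into_right[OF bij])
  then show ?thesis
    unfolding graph_isomorphism_def using bij_betw_inv_into[OF bij] by simp
qed

lemma isomorphic_deterministic: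
  assumes "graph_isomorphism f G H" "deterministic_graph H"
  shows "deterministic_graph G"
  unfolding deterministic_graph_def
proof (intro allI impI)
  fix r a s t
  assume e: "(r, a, s) \<in> G \<and> (r, a, t) \<in> G"
  then have "f s = f t"
    using assms graph_isomorphism_edge unfolding deterministic_graph_def by meson
  then show "s = t"
    using e graph_isomorphism_bij[OF assms(1)] edge_vertices
    by (metis bij_betw_inv_into_left)
qed

lemma isomorphic_simple:
  assumes "graph_isomorphism f G H" "simple_graph H"
  shows "simple_graph G"
  using assms graph_isomorphism_edge unfolding simple_graph_def by meson

text \<open>Isomorphisms carry paths to paths. This transports forward along \<open>f\<close>,
  unlike the neighbouring transfer lemmas, so pulling a root back requires the inverse
  isomorphism.\<close>

lemma isomorphic_root:
  assumes f: "graph_isomorphism f G H" and r: "graph_root G r"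
  shows "graph_root H (f r)"
  unfolding graph_root_def
proof (intro conjI ballI)
  show "f r \<in> vertices H"
    using graph_isomorphism_vertex[OF f] r by (simp add: graph_root_def)
next
  fix u assume "u \<in> vertices H"
  then obtain t where t: "t \<in> vertices G" "u = f t"
    using graph_isomorphism_bij[OF f] by (auto simp: bij_betw_def)
  have "(r, t) \<in> (step_rel G)\<^sup>*"
    using r t by (simp add: graph_root_def)
  then have "(f r, f t) \<in> (step_rel H)\<^sup>*"
  proof (induction rule: rtrancl_induct)
    case (step y z)
    then have "(f y, f z) \<in> step_rel H"
      using graph_isomorphism_edge[OF f] by (auto simp: step_rel_def)
    with step.IH show ?case by simp
  qed simp
  with t show "(f r, u) \<in> (step_rel H)\<^sup>*" by simp
qed

text \<open>Automorphisms of \<open>H\<close> are conjugated by \<open>f\<close> into automorphisms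
  of \<open>G\<close>.\<close>

lemma isomorphic_vertex_transitive:
  assumes f: "graph_isomorphism f G H" and H: "vertex_transitive H"
  shows "vertex_transitive G"
  unfolding vertex_transitive_def
proof (intro ballI)
  fix s t assume st: "s \<in> vertices G" "t \<in> vertices G"
  obtain h where h: "graph_isomorphism h H H" "h (f s) = f t"
    using H st graph_isomorphism_vertex[OF f]
    unfolding vertex_transitive_def graph_automorphism_def by blast
  have "graph_isomorphism (inv_into (vertices G) f \<circ> (h \<circ> f)) G G"
    using graph_isomorphism_comp[OF graph_isomorphism_comp[OF f h(1)] graph_isomorphism_inv[OF f]] .
  moreover have "(inv_into (vertices G) f \<circ> (h \<circ> f)) s = t"
    using h(2) st bij_betw_inv_into_left[OF graph_isomorphism_bij[OF f]] by simp
  ultimately show "\<exists>h. graph_automorphism h G \<and> h s = t"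
    unfolding graph_automorphism_def by blast
qed

text \<open>Induction along a path from \<open>r\<close>: once the images of \<open>y\<close> agree,
  an edge from \<open>y\<close> to \<open>z\<close> has two images with the same source and label,
  and determinism of \<open>H\<close> identifies their goals.\<close>

lemma deterministic_isomorphism_unique:
  assumes f: "graph_isomorphism f G H" and g: "graph_isomorphism g G H"
    and H: "deterministic_graph H" and r: "graph_root G r" and eq: "f r = g r"
    and t: "t \<in> vertices G"
  shows "f t = g t"
proof -
  have "(r, t) \<in> (step_rel G)\<^sup>*"
    using r t by (simp add: graph_root_def)
  then show ?thesis
  proof (induction rule: rtrancl_induct)
    case (step y z)
    then obtain a where "(y, a, z) \<in> G" by (auto simp: step_rel_def)
    then have "(f y, a, f z) \<in> H" "(f y, a, g z) \<in> H"
      using graph_isomorphism_edge[OF f] graph_isomorphism_edge[OF g] step.IH by metis+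
    then show ?case using H unfolding deterministic_graph_def by blast
  qed (rule eq)
qed

section \<open>Properties of Cayley graphs\<close>

lemma (in monoid) foldr_mult_closed:
  "set hs \<subseteq> carrier G \<Longrightarrow> foldr (\<otimes>) hs \<one> \<in> carrier G"
  by (induction hs) auto

text \<open>Paths are extended at their end while \<open>foldr\<close> unfolds at the front; this
  reconciles the two when generation is proved from reachability.\<close>

lemma (in monoid) foldr_mult_snoc:
  "set hs \<subseteq> carrier G \<Longrightarrow> h \<in> carrier G \<Longrightarrow>
    foldr (\<otimes>) (hs @ [h]) \<one> = foldr (\<otimes>) hs \<one> \<otimes> h"
  by (induction hs) (auto simp: m_assoc foldr_mult_closed)

context group
begin

lemma vertices_cayley_graph:
  assumes "H \<subseteq> carrier G" "H \<noteq> {}"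
  shows "vertices (cayley_graph G H l) = carrier G"
  using assms by (auto simp: vertices_def cayley_graph_def)

lemma deterministic_cayley_graph:
  "inj_on l H \<Longrightarrow> deterministic_graph (cayley_graph G H l)"
  by (auto simp: deterministic_graph_def cayley_graph_def inj_on_def)

text \<open>Left cancellation recovers the generator from the two ends of an edge.\<close>

lemma simple_cayley_graph:
  "H \<subseteq> carrier G \<Longrightarrow> simple_graph (cayley_graph G H l)"
  by (auto simp: simple_graph_def cayley_graph_def subset_iff)

text \<open>The start \<open>g\<close> is arbitrary because the induction restarts at
  \<open>g \<otimes> h\<close> after the first generator.\<close>

lemma cayley_graph_path:
  assumes "H \<subseteq> carrier G" "set hs \<subseteq> H" "g \<in> carrier G"
  shows "(g, g \<otimes> foldr (\<otimes>) hs \<one>) \<in> (step_rel (cayley_graph G H l))\<^sup>*"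
  using assms(2,3)
proof (induction hs arbitrary: g)
  case (Cons h hs)
  have h: "h \<in> H" "h \<in> carrier G" "set hs \<subseteq> carrier G"
    using Cons.prems assms(1) by auto
  have "(g, g \<otimes> h) \<in> step_rel (cayley_graph G H l)"
    using h Cons.prems by (auto simp: step_rel_def cayley_graph_def)
  moreover have "(g \<otimes> h, g \<otimes> h \<otimes> foldr (\<otimes>) hs \<one>) \<in> (step_rel (cayley_graph G H l))\<^sup>*"
    using Cons h by simp
  ultimately show ?case
    using h Cons.prems by (simp add: m_assoc foldr_mult_closed converse_rtrancl_into_rtrancl)
qed simp

lemma cayley_graph_root:
  assumes "H \<subseteq> carrier G" "H \<noteq> {}" "generating G H"
  shows "graph_root (cayley_graph G H l) \<one>"
  unfolding graph_root_def vertices_cayley_graph[OF assms(1,2)]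
proof (intro conjI ballI one_closed)
  fix t assume "t \<in> carrier G"
  then obtain hs where hs: "set hs \<subseteq> H" "t = foldr (\<otimes>) hs \<one>"
    using assms(3) unfolding generating_def by blast
  then have "t = \<one> \<otimes> foldr (\<otimes>) hs \<one>"
    using assms(1) foldr_mult_closed[of hs] by simp
  then show "(\<one>, t) \<in> (step_rel (cayley_graph G H l))\<^sup>*"
    using cayley_graph_path[OF assms(1) hs(1) one_closed] by metis
qed

text \<open>Edges multiply by generators on the right, so by associativity left translations
  preserve them.\<close>

lemma vertex_transitive_cayley_graph:
  assumes H: "H \<subseteq> carrier G" "H \<noteq> {}"
  shows "vertex_transitive (cayley_graph G H l)"
  unfolding vertex_transitive_def graph_automorphism_def vertices_cayley_graph[OF H]
proof (intro ballI)
  fix s t assume st: "s \<in> carrier G" "t \<in> carrier G"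
  define c where "c = t \<otimes> inv s"
  have c: "c \<in> carrier G" using st by (simp add: c_def)
  have "bij_betw ((\<otimes>) c) (carrier G) (carrier G)"
    by (rule bij_betw_byWitness[where f' = "(\<otimes>) (inv c)"]) (use c in \<open>auto simp flip: m_assoc\<close>)
  moreover have "(x, a, y) \<in> cayley_graph G H l \<longleftrightarrow> (c \<otimes> x, a, c \<otimes> y) \<in> cayley_graph G H l"
    if "x \<in> carrier G" "y \<in> carrier G" for x a y
  proof -
    \<comment> \<open>Cancelling \<open>c\<close> shows that the same generator labels an edge and
      its translate.\<close>
    have "c \<otimes> y = c \<otimes> x \<otimes> h \<longleftrightarrow> y = x \<otimes> h" if "h \<in> H" for h
      using that c \<open>x \<in> carrier G\<close> \<open>y \<in> carrier G\<close> H(1) by (auto simp: m_assoc subset_iff)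
    then show ?thesis using that c by (auto simp: cayley_graph_def)
  qed
  ultimately have "graph_isomorphism ((\<otimes>) c) (cayley_graph G H l) (cayley_graph G H l)"
    by (simp add: graph_isomorphism_def vertices_cayley_graph[OF H])
  moreover have "c \<otimes> s = t" using st by (simp add: c_def m_assoc)
  ultimately show "\<exists>h. graph_isomorphism h (cayley_graph G H l) (cayley_graph G H l) \<and> h s = t"
    by blast
qed

end

lemma is_cayley_graph_properties:
  assumes "is_cayley_graph TYPE('g) A G"
  shows "deterministic_graph G \<and> rooted_graph G \<and> simple_graph G \<and> vertex_transitive G"
proof -
  obtain Gr :: "'g monoid" and H l f where Gr: "group Gr"
    and H: "H \<subseteq> carrier Gr" "H \<noteq> {}" "generating Gr H" and l: "inj_on l H"
    and f: "graph_isomorphism f G (cayley_graph Gr H l)"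
    using assms unfolding is_cayley_graph_def isomorphic_graphs_def by blast
  interpret group Gr by fact
  show ?thesis
    using isomorphic_deterministic[OF f deterministic_cayley_graph[OF l]]
      isomorphic_root[OF graph_isomorphism_inv[OF f] cayley_graph_root[OF H]]
      isomorphic_simple[OF f simple_cayley_graph[OF H(1)]]
      isomorphic_vertex_transitive[OF f vertex_transitive_cayley_graph[OF H(1,2)]]
    unfolding rooted_graph_def by blast
qed

section \<open>The group structure on the vertices\<close>

text \<open>The group is built on the vertices themselves, which is why the type \<open>'v\<close>
  suffices for it.\<close>

lemma vertex_transitive_is_cayley_graph:
  fixes G :: "('v, 'a) lgraph"
  assumes A: "graph A G" and det: "deterministic_graph G" and root: "graph_root G r"
    and simple: "simple_graph G" and trans: "vertex_transitive G"
  shows "is_cayley_graph TYPE('v) A G"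
proof -
  let ?V = "vertices G"
  have r: "r \<in> ?V" using root by (simp add: graph_root_def)
  have "\<forall>s\<in>?V. \<exists>h. graph_isomorphism h G G \<and> h r = s"
    using trans r unfolding vertex_transitive_def graph_automorphism_def by blast
  then obtain \<phi> where iso: "\<And>s. s \<in> ?V \<Longrightarrow> graph_isomorphism (\<phi> s) G G"
    and at_r: "\<And>s. s \<in> ?V \<Longrightarrow> \<phi> s r = s"
    by metis
  note vertex = graph_isomorphism_vertex[OF iso]
  \<comment> \<open>Both \<open>h\<close> and \<open>\<phi> (h r)\<close> send the root to
    \<open>h r\<close>.\<close>
  have unique: "\<phi> (h r) t = h t" if "graph_isomorphism h G G" "t \<in> ?V" for h t
    using deterministic_isomorphism_unique[OF iso that(1) det root at_r that(2)]
      graph_isomorphism_vertex[OF that(1) r] by simp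
  \<comment> \<open>The composite of \<open>\<phi> t\<close> followed by \<open>\<phi> s\<close>
    sends \<open>r\<close> to \<open>\<phi> s t\<close>, so \<open>unique\<close> applies to
    it.\<close>
  have assoc: "\<phi> (\<phi> s t) u = \<phi> s (\<phi> t u)" if "s \<in> ?V" "t \<in> ?V" "u \<in> ?V" for s t u
    using unique[OF graph_isomorphism_comp[OF iso iso], of t s u] that by (simp add: at_r)
  define Gr where "Gr = \<lparr>carrier = ?V, monoid.mult = \<phi>, one = r\<rparr>"
  have Gr_simps [simp]: "carrier Gr = ?V" "monoid.mult Gr = \<phi>" "one Gr = r"
    by (simp_all add: Gr_def)
  have group: "group Gr"
  proof (rule groupI)
    fix s assume s: "s \<in> carrier Gr"
    then obtain h where h: "graph_isomorphism h G G" "h s = r"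
      using trans r unfolding vertex_transitive_def graph_automorphism_def by auto
    \<comment> \<open>The left inverse is \<open>h r\<close>: by \<open>unique\<close>, multiplying
      \<open>s\<close> by it on the left gives \<open>h s = r\<close>.\<close>
    show "\<exists>t\<in>carrier Gr. t \<otimes>\<^bsub>Gr\<^esub> s = \<one>\<^bsub>Gr\<^esub>"
      using unique[OF h(1)] s h graph_isomorphism_vertex[OF h(1) r] by auto
    show "\<one>\<^bsub>Gr\<^esub> \<otimes>\<^bsub>Gr\<^esub> s = s"
      using unique[OF graph_isomorphism_id, of s] s by simp
  qed (auto simp: r vertex assoc)
  interpret group Gr by (rule group)
  define H where "H = {h. \<exists>a. (r, a, h) \<in> G}"
  \<comment> \<open>Simplicity makes the label of an edge from \<open>r\<close> to \<open>h\<close>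
    unique; outside \<open>H\<close> the value is irrelevant.\<close>
  define l where "l h = (THE a. (r, a, h) \<in> G)" for h
  have l: "l h = a" if "(r, a, h) \<in> G" for a h
    unfolding l_def using that simple by (auto simp: simple_graph_def)
  have H: "H \<subseteq> ?V" by (auto simp: H_def edge_vertices)
  \<comment> \<open>Since \<open>\<phi> s\<close> maps \<open>r\<close> to \<open>s\<close> and is
    onto the vertices, every edge leaving \<open>s\<close> is the image of an edge leaving
    \<open>r\<close>.\<close>
  have edge: "\<exists>h. (r, a, h) \<in> G \<and> t = \<phi> s h" if "(s, a, t) \<in> G" for s a t
  proof -
    have st: "s \<in> ?V" "t \<in> ?V" using that by (rule edge_vertices)+
    then obtain h where h: "h \<in> ?V" "t = \<phi> s h"
      using graph_isomorphism_bij[OF iso[OF st(1)]] by (auto simp: bij_betw_def)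
    then show ?thesis
      using graph_isomorphism_edge_iff[OF iso[OF st(1)] r h(1), of a] that st by (auto simp: at_r)
  qed
  have cayley: "cayley_graph Gr H l = G"
  proof (intro equalityI subsetI)
    fix e assume "e \<in> cayley_graph Gr H l"
    then obtain g h a where e: "e = (g, a, \<phi> g h)" and g: "g \<in> ?V" and h: "(r, a, h) \<in> G"
      by (auto simp: cayley_graph_def H_def l)
    show "e \<in> G"
      using graph_isomorphism_edge[OF iso[OF g] h] by (simp add: e at_r[OF g])
  next
    fix e assume "e \<in> G"
    moreover obtain s a t where e: "e = (s, a, t)" by (cases e)
    ultimately obtain h where "(r, a, h) \<in> G" "t = \<phi> s h" "s \<in> ?V"
      using edge edge_vertices by metis
    then show "e \<in> cayley_graph Gr H l"
      by (auto simp: cayley_graph_def H_def e l intro!: exI[of _ h])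
  qed
  \<comment> \<open>Any edge of \<open>G\<close> comes from one leaving \<open>r\<close>.\<close>
  have nonempty: "H \<noteq> {}"
    using A edge unfolding graph_def H_def by fastforce
  \<comment> \<open>Determinism at \<open>r\<close>: generators with equal labels coincide.\<close>
  have inj: "inj_on l H"
    using det by (auto simp: inj_on_def H_def l deterministic_graph_def)
  have labels: "l ` H \<subseteq> A"
    using A by (auto simp: H_def l graph_def)
  have gen: "generating Gr H"
    unfolding generating_def
  proof
    fix g assume "g \<in> carrier Gr"
    then have "(r, g) \<in> (step_rel G)\<^sup>*" using root by (simp add: graph_root_def)
    then show "\<exists>hs. set hs \<subseteq> H \<and> g = foldr (\<otimes>\<^bsub>Gr\<^esub>) hs \<one>\<^bsub>Gr\<^esub>"
    proof (induction rule: rtrancl_induct)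
      case base
      show ?case by (rule exI[of _ "[]"]) simp
    next
      case (step s t)
      then obtain hs where hs: "set hs \<subseteq> H" "s = foldr (\<otimes>\<^bsub>Gr\<^esub>) hs \<one>\<^bsub>Gr\<^esub>" by blast
      \<comment> \<open>Following an edge is right multiplication by a generator, so a path from
        \<open>r\<close> spells a product.\<close>
      obtain h where h: "h \<in> H" "t = \<phi> s h"
        using step.hyps(2) edge unfolding step_rel_def H_def by fast
      have "set hs \<subseteq> carrier Gr" "h \<in> carrier Gr" using hs(1) h(1) H by auto
      from foldr_mult_snoc[OF this] have "t = foldr (\<otimes>\<^bsub>Gr\<^esub>) (hs @ [h]) \<one>\<^bsub>Gr\<^esub>"
        using hs(2) h(2) by simp
      then show ?case using hs(1) h(1) by (intro exI[of _ "hs @ [h]"]) simp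
    qed
  qed
  have "isomorphic_graphs G (cayley_graph Gr H l)"
    unfolding isomorphic_graphs_def cayley using graph_isomorphism_id by blast
  then show ?thesis
    unfolding is_cayley_graph_def using group H nonempty gen inj labels
    by (intro exI[of _ Gr] exI[of _ H] exI[of _ l]) simp
qed

text \<open>The equivalence fixes the group type to \<open>'v\<close>; the second conjunct, with
  \<open>'g\<close> arbitrary, shows that groups in other types yield no further Cayley
  graphs.\<close>

theorem theorem4p7:
  fixes A :: "'a set" and G :: "('v, 'a) lgraph"
  assumes "graph A G"
  shows "(is_cayley_graph TYPE('v) A G \<longleftrightarrow>
            deterministic_graph G \<and> rooted_graph G \<and> simple_graph G \<and> vertex_transitive G) \<and>
         (is_cayley_graph TYPE('g) A G \<longrightarrow>
            deterministic_graph G \<and> rooted_graph G \<and> simple_graph G \<and> vertex_transitive G)"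
  using is_cayley_graph_properties[where 'g = 'v, of A G]
    is_cayley_graph_properties[where 'g = 'g, of A G] vertex_transitive_is_cayley_graph[OF assms]
  unfolding rooted_graph_def by blast

end
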